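(* Let $\Sigma$ be a finite alphabet and $d\ge2$. For any $\delta>0$, $t_1,\dots,t_d\in\mathbb{N}$ and numbers $0<\rho_\beta(\sigma)\le1$ ($\beta\in\prod_{j=1}^d\{1,\dots,t_j\}$, $\sigma\in\Sigma$) there is $\varepsilon>0$ such that the following holds. Let $\mathcal{B}=\{B_\beta\}$ be a block partition of a $d$-dimensional matrix $A$ over $\Sigma$ into blocks $B_\beta$ of sizes $m^1_{\beta_1}\times\cdots\times m^d_{\beta_d}$, $\beta_j=1,\dots,t_j$. If every $B_\beta$ is an $\varepsilon$-regular pattern with densities $\rho_\beta(\sigma)$ of the symbols $\sigma\in\Sigma$, then for every matrix $C=(c_\beta)$ of sizes $t_1\times\cdots\times t_d$ over $\Sigma$ the number of appearances of $C$ in $A$ is at least $$(1-\delta)\prod_{\beta_1=1}^{t_1}m^1_{\beta_1}\cdots\prod_{\beta_d=1}^{t_d}m^d_{\beta_d}\cdot\prod_{\beta}\rho_\beta(c_\beta).$$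
   Context: A $d$-dimensional matrix of sizes $n^1\times\cdots\times n^d$ over $\Sigma$ is an array $(a_\alpha)$, $\alpha\in\prod_i\{1,\dots,n^i\}$, with entries in $\Sigma$; binary means $\Sigma=\{0,1\}$ and then the density is the fraction of entries equal to $1$. A block is a submatrix. A block partition into blocks $B_\beta$ of sizes $m^1_{\beta_1}\times\cdots\times m^d_{\beta_d}$ is given by partitioning, for each coordinate $j$, the index set into parts of sizes $m^j_1,\dots,m^j_{t_j}$, with $B_\beta$ the submatrix on the product of the parts indexed by $\beta$. A hyperplane of a $d$-dimensional matrix is a maximal $(d-1)$-dimensional block obtained by fixing one index coordinate (its direction). The entrywise multiplication of a binary matrix $L$ with a matrix $H$ of the same sizes keeps the entries of $H$ where $L$ is $1$ and puts $0$ where $L$ is $0$. $\varepsilon$-regular patterns are defined inductively on dimension: a $1$-dimensional $\varepsilon$-regular pattern with densities $\rho_\sigma$ is any $1$-dimensional matrix in which the density of each symbol $\sigma$ equals $\rho_\sigma$; a $d$-dimensional $\varepsilon$-regular pattern with densities $\rho_\sigma$ is a $d$-dimensional matrix $X$ such that for every direction $i$ and every $(d-1)$-dimensional binary $\varepsilon$-regular pattern $L$ of the same sizes as the hyperplanes of $X$ of direction $i$ and of density $\rho'\ge\varepsilon$, the entrywise multiplication of $L$ with at least $(1-\varepsilon)n^i$ hyperplanes of $X$ of direction $i$ is a $(d-1)$-dimensional $\varepsilon$-regular pattern with densities of $\sigma$ at least $\rho_\sigma\rho'(1-\varepsilon)$. The number of appearances of $C$ in $A$ is the number of submatrices of $A$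 that can be obtained from $C$ by permutations of hyperplanes. *)

theory Defs
  imports "HOL-Combinatorics.Permutations" "HOL-Library.Disjoint_Sets" Complex_Main
begin

(* A d-dimensional matrix is a function on index lists of length d together with its list of
   sizes; only its values on "indices ns" matter.  Indices are counted from 0. *)

definition indices :: "nat list \<Rightarrow> nat list set" where
  "indices ns = {\<alpha>. length \<alpha> = length ns \<and> (\<forall>j < length ns. \<alpha> ! j < ns ! j)}"

definition density :: "nat list \<Rightarrow> (nat list \<Rightarrow> 'b) \<Rightarrow> 'b \<Rightarrow> real" where
  "density ns X s = real (card {\<alpha> \<in> indices ns. X \<alpha> = s}) / real (card (indices ns))"

definition delete_nth :: "nat \<Rightarrow> 'b list \<Rightarrow> 'b list" where
  "delete_nth i xs = take i xs @ drop (Suc i) xs"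

definition hyperplane :: "nat \<Rightarrow> nat \<Rightarrow> (nat list \<Rightarrow> 'b) \<Rightarrow> nat list \<Rightarrow> 'b" where
  "hyperplane i k X = (\<lambda>\<alpha>. X (take i \<alpha> @ k # drop i \<alpha>))"

(* Rows, columns, ... of the submatrix keep the order they have in A. *)
definition submatrix :: "(nat list \<Rightarrow> 'b) \<Rightarrow> nat set list \<Rightarrow> nat list \<Rightarrow> 'b" where
  "submatrix A S = (\<lambda>\<beta>. A (map2 (\<lambda>T k. sorted_list_of_set T ! k) S \<beta>))"

(* Entrywise multiplication by a binary matrix L (True is 1, False is 0) produces zeros that
   must not be confused with a symbol of the alphabet (which may itself contain a symbol named 0).
   Matrices over an alphabet 'a that may contain such zeros have entries in 'a option,
   None being the zero. *)
definition mask :: "(nat list \<Rightarrow> bool) \<Rightarrow> (nat list \<Rightarrow> 'a option) \<Rightarrow> nat list \<Rightarrow> 'a option" where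
  "mask L H = (\<lambda>\<alpha>. if L \<alpha> then H \<alpha> else None)"

(* Regular patterns are defined for binary matrices first, since these occur as the test
   patterns L for every alphabet.  The density of a binary matrix refers to the entry 1 only.
   The second argument is the dimension, i.e. the length of the list ns of sizes. *)
fun binary_regular_pattern ::
    "real \<Rightarrow> nat \<Rightarrow> nat list \<Rightarrow> (nat list \<Rightarrow> bool) \<Rightarrow> real \<Rightarrow> bool" where
  "binary_regular_pattern \<epsilon> 0 ns X \<rho> \<longleftrightarrow> False"
| "binary_regular_pattern \<epsilon> (Suc 0) ns X \<rho> \<longleftrightarrow> density ns X True = \<rho>"
| "binary_regular_pattern \<epsilon> (Suc (Suc d)) ns X \<rho> \<longleftrightarrow>
     (\<forall>i < Suc (Suc d). \<forall>L \<rho>'.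
        \<epsilon> \<le> \<rho>' \<and> \<rho>' \<le> 1 \<and> binary_regular_pattern \<epsilon> (Suc d) (delete_nth i ns) L \<rho>' \<longrightarrow>
        (1 - \<epsilon>) * real (ns ! i) \<le>
          real (card {k. k < ns ! i \<and>
            (\<exists>\<rho>''. \<rho> * \<rho>' * (1 - \<epsilon>) \<le> \<rho>'' \<and>
               binary_regular_pattern \<epsilon> (Suc d) (delete_nth i ns)
                 (\<lambda>\<alpha>. L \<alpha> \<and> hyperplane i k X \<alpha>) \<rho>'')}))"

fun regular_pattern ::
    "real \<Rightarrow> nat \<Rightarrow> nat list \<Rightarrow> (nat list \<Rightarrow> 'a option) \<Rightarrow> ('a \<Rightarrow> real) \<Rightarrow> bool" where
  "regular_pattern \<epsilon> 0 ns X \<rho> \<longleftrightarrow> False"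
| "regular_pattern \<epsilon> (Suc 0) ns X \<rho> \<longleftrightarrow> (\<forall>\<sigma>. density ns X (Some \<sigma>) = \<rho> \<sigma>)"
| "regular_pattern \<epsilon> (Suc (Suc d)) ns X \<rho> \<longleftrightarrow>
     (\<forall>i < Suc (Suc d). \<forall>L \<rho>'.
        \<epsilon> \<le> \<rho>' \<and> \<rho>' \<le> 1 \<and> binary_regular_pattern \<epsilon> (Suc d) (delete_nth i ns) L \<rho>' \<longrightarrow>
        (1 - \<epsilon>) * real (ns ! i) \<le>
          real (card {k. k < ns ! i \<and>
            (\<exists>\<rho>''. (\<forall>\<sigma>. \<rho> \<sigma> * \<rho>' * (1 - \<epsilon>) \<le> \<rho>'' \<sigma>) \<and>
               regular_pattern \<epsilon> (Suc d) (delete_nth i ns)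
                 (mask L (hyperplane i k X)) \<rho>'')}))"

(* The binary notion is the general one for the one-letter alphabet. *)
lemma binary_regular_pattern_iff:
  "binary_regular_pattern \<epsilon> d ns X r \<longleftrightarrow>
   regular_pattern \<epsilon> d ns (\<lambda>\<alpha>. if X \<alpha> then Some () else None) (\<lambda>_. r)"
proof (induction \<epsilon> d ns X r rule: binary_regular_pattern.induct)
  case (2 \<epsilon> ns X \<rho>)
  have "(if X \<alpha> then Some () else None) = Some \<sigma> \<longleftrightarrow> X \<alpha>" for \<alpha> \<sigma>
    by simp
  then show ?case
    by (simp add: density_def)
next
  case (3 \<epsilon> d ns X \<rho>)
  have mask: "mask L (hyperplane i k (\<lambda>\<alpha>. if X \<alpha> then Some () else None)) =
      (\<lambda>\<alpha>. if L \<alpha> \<and> hyperplane i k X \<alpha> then Some () else None)" for L i k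
    by (auto simp: mask_def hyperplane_def)
  have ex: "(\<exists>f :: unit \<Rightarrow> real. P f) \<longleftrightarrow> (\<exists>x. P (\<lambda>_. x))" for P
  proof
    assume "\<exists>f. P f"
    then obtain f where "P f" ..
    moreover have "f = (\<lambda>_. f ())" by auto
    ultimately show "\<exists>x. P (\<lambda>_. x)" by metis
  qed auto
  have eq: "(\<exists>\<rho>''. \<rho> * \<rho>' * (1 - \<epsilon>) \<le> \<rho>'' \<and>
           binary_regular_pattern \<epsilon> (Suc d) (delete_nth i ns)
             (\<lambda>\<alpha>. L \<alpha> \<and> hyperplane i k X \<alpha>) \<rho>'') \<longleftrightarrow>
       (\<exists>\<rho>''. (\<forall>\<sigma>::unit. \<rho> * \<rho>' * (1 - \<epsilon>) \<le> \<rho>'' \<sigma>) \<and>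
           regular_pattern \<epsilon> (Suc d) (delete_nth i ns)
             (mask L (hyperplane i k (\<lambda>\<alpha>. if X \<alpha> then Some () else None))) \<rho>'')"
    if "i < Suc (Suc d)" "\<epsilon> \<le> \<rho>' \<and> \<rho>' \<le> 1 \<and>
        binary_regular_pattern \<epsilon> (Suc d) (delete_nth i ns) L \<rho>'" for i L \<rho>' k
    unfolding mask ex using 3 that by simp
  show ?case
    unfolding binary_regular_pattern.simps regular_pattern.simps
    using eq by (intro all_cong1 imp_cong refl) auto
qed simp

(* P j b is the b-th part of the index set of coordinate j, and m j b is its size. *)
definition block_partition ::
    "nat list \<Rightarrow> nat list \<Rightarrow> (nat \<Rightarrow> nat \<Rightarrow> nat) \<Rightarrow> (nat \<Rightarrow> nat \<Rightarrow> nat set) \<Rightarrow> bool" where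
  "block_partition ns ts m P \<longleftrightarrow> length ns = length ts \<and>
     (\<forall>j < length ts.
        partition_on {..<ns ! j} (P j ` {..<ts ! j}) \<and> inj_on (P j) {..<ts ! j} \<and>
        (\<forall>b < ts ! j. card (P j b) = m j b))"

definition block_sizes :: "(nat \<Rightarrow> nat \<Rightarrow> nat) \<Rightarrow> nat list \<Rightarrow> nat list" where
  "block_sizes m \<beta> = map (\<lambda>j. m j (\<beta> ! j)) [0..<length \<beta>]"

definition block ::
    "(nat list \<Rightarrow> 'b) \<Rightarrow> (nat \<Rightarrow> nat \<Rightarrow> nat set) \<Rightarrow> nat list \<Rightarrow> nat list \<Rightarrow> 'b" where
  "block A P \<beta> = submatrix A (map (\<lambda>j. P j (\<beta> ! j)) [0..<length \<beta>])"

(* A submatrix is identified with its position, i.e. with the lists S of index sets.  It is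
   obtained from C by applying to each direction j a permutation \<pi> j of the hyperplanes of C. *)
definition appearances ::
    "nat list \<Rightarrow> (nat list \<Rightarrow> 'b) \<Rightarrow> nat list \<Rightarrow> (nat list \<Rightarrow> 'b) \<Rightarrow> nat" where
  "appearances ts C ns A = card {S. length S = length ns \<and>
     (\<forall>j < length ns. S ! j \<subseteq> {..<ns ! j} \<and> card (S ! j) = ts ! j) \<and>
     (\<exists>\<pi>. (\<forall>j < length ts. \<pi> j permutes {..<ts ! j}) \<and>
        (\<forall>\<beta> \<in> indices ts.
           submatrix A S \<beta> = C (map (\<lambda>j. \<pi> j (\<beta> ! j)) [0..<length \<beta>])))}"

end

theory Submission imports Defs begin

text \<open>Choose one index from every part of every coordinate, coordinate by coordinate. In each block
  keep the binary matrix marking the symbol prescribed by \<open>C\<close>. Fixing an index of the first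
  coordinate cuts hyperplanes out of the blocks above that part; for each position \<open>\<beta>\<close> of the remaining
  coordinates, the hyperplanes cut out so far are multiplied together. This product is a regular
  pattern of one dimension less, so it can serve as the test pattern \<open>L\<close> for the next hyperplane:
  all but an \<open>\<epsilon>\<close> fraction of the indices, for each \<open>\<beta>\<close>, multiply its density by at least
  \<open>\<rho> (1 - \<epsilon>)\<close>. Once the first coordinate is exhausted, a binary instance of the same
  problem in one dimension less remains; in dimension 1 the choices are independent and the count is
  a product of densities.\<close>

section \<open>Index sets and counting lists entry by entry\<close>

lemma indices_Nil [simp]: "indices [] = {[]}"
  by (auto simp: indices_def)

lemma indices_Cons: "indices (n # ns) = {k # \<alpha> | k \<alpha>. k < n \<and> \<alpha> \<in> indices ns}"
proof (rule set_eqI)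
  fix \<beta>
  show "\<beta> \<in> indices (n # ns) \<longleftrightarrow> \<beta> \<in> {k # \<alpha> | k \<alpha>. k < n \<and> \<alpha> \<in> indices ns}"
    by (cases \<beta>) (auto simp: indices_def All_less_Suc2)
qed

lemma Cons_in_indices_iff [simp]: "k # \<alpha> \<in> indices (n # ns) \<longleftrightarrow> k < n \<and> \<alpha> \<in> indices ns"
  by (simp add: indices_Cons)

lemma indices_Cons_image: "indices (n # ns) = (\<lambda>(k, \<alpha>). k # \<alpha>) ` ({..<n} \<times> indices ns)"
  by (auto simp: indices_Cons)

lemma finite_indices [simp]: "finite (indices ns)"
  by (induction ns) (simp_all add: indices_Cons_image)

text \<open>The product over the remaining coordinates stands outside because, up to powers of
  \<open>1 - \<epsilon>\<close>, each inner product over \<open>k\<close> becomes one density of the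
  lower-dimensional instance.\<close>

lemma prod_indices_Cons:
  "(\<Prod>\<beta>\<in>indices (n # ns). f \<beta>) = (\<Prod>\<alpha>\<in>indices ns. \<Prod>k<n. f (k # \<alpha>))"
proof -
  have "(\<Prod>\<beta>\<in>indices (n # ns). f \<beta>) = (\<Prod>(k, \<alpha>)\<in>{..<n} \<times> indices ns. f (k # \<alpha>))"
    unfolding indices_Cons_image
    by (subst prod.reindex) (auto simp: inj_on_def case_prod_unfold)
  then show ?thesis
    by (simp add: prod.cartesian_product[symmetric] prod.swap[of _ "indices ns"])
qed

lemma card_Cons_Sigma:
  assumes "finite G" "\<And>x. x \<in> G \<Longrightarrow> finite (T x)"
  shows "card {x # xs | x xs. x \<in> G \<and> xs \<in> T x} = (\<Sum>x\<in>G. card (T x))"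
proof -
  have "{x # xs | x xs. x \<in> G \<and> xs \<in> T x} = (\<lambda>(x, xs). x # xs) ` Sigma G T"
    by auto
  moreover have "inj_on (\<lambda>(x, xs). x # xs) (Sigma G T)"
    by (auto simp: inj_on_def)
  ultimately show ?thesis
    using assms by (simp add: card_image)
qed

text \<open>Greedy counting: every good head leaves at least \<open>a\<close> completions. It drives
  both inductions, over the parts of one coordinate and over the coordinates.\<close>

lemma card_Cons_ge:
  assumes "finite S" "finite G" "\<And>x. x \<in> G \<Longrightarrow> finite (T x)"
    and "\<And>x xs. x \<in> G \<Longrightarrow> xs \<in> T x \<Longrightarrow> x # xs \<in> S"
    and a: "\<And>x. x \<in> G \<Longrightarrow> a \<le> real (card (T x))"
  shows "real (card G) * a \<le> real (card S)"
proof -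
  have "real (card G) * a \<le> (\<Sum>x\<in>G. real (card (T x)))"
    using sum_bounded_below[of G a "\<lambda>x. real (card (T x))"] a by simp
  also have "\<dots> = real (card {x # xs | x xs. x \<in> G \<and> xs \<in> T x})"
    using assms by (simp add: card_Cons_Sigma)
  also have "\<dots> \<le> real (card S)"
    using assms by (intro of_nat_mono card_mono) auto
  finally show ?thesis .
qed

text \<open>Conditions on different entries are independent, so the count factors; this settles
  dimension 1.\<close>

lemma card_indices_all_nth:
  "card {xs \<in> indices ms. \<forall>b < length ms. Q b (xs ! b)} =
   (\<Prod>b<length ms. card {k. k < ms ! b \<and> Q b k})"
proof (induction ms arbitrary: Q)
  case (Cons m ms)
  have "{xs \<in> indices (m # ms). \<forall>b < length (m # ms). Q b (xs ! b)} =
      {x # xs | x xs. x \<in> {k. k < m \<and> Q 0 k} \<and>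
        xs \<in> {xs \<in> indices ms. \<forall>b < length ms. Q (Suc b) (xs ! b)}}"
    by (auto simp: indices_Cons All_less_Suc2)
  also have "card \<dots> = card {k. k < m \<and> Q 0 k} * (\<Prod>b<length ms. card {k. k < ms ! b \<and> Q (Suc b) k})"
    by (subst card_Cons_Sigma) (simp_all add: Cons.IH[of "\<lambda>b. Q (Suc b)"])
  finally show ?case
    by (simp add: prod.lessThan_Suc_shift del: prod.lessThan_Suc)
qed (simp add: conj_commute)

text \<open>Union bound: each condition excludes at most \<open>\<epsilon> * n\<close> indices. The
  induction step is inclusion-exclusion for two subsets of \<open>{..<n}\<close>.\<close>

lemma card_all_ge:
  assumes "finite I"
    and "\<And>i. i \<in> I \<Longrightarrow> (1 - \<epsilon>) * real n \<le> real (card {k. k < n \<and> P i k})"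
  shows "(1 - real (card I) * \<epsilon>) * real n \<le> real (card {k. k < n \<and> (\<forall>i\<in>I. P i k)})"
  using assms
proof (induction I rule: finite_induct)
  case (insert i I)
  let ?A = "{k. k < n \<and> P i k}" and ?B = "{k. k < n \<and> (\<forall>i\<in>I. P i k)}"
  have "card (?A \<union> ?B) \<le> card {..<n}"
    by (intro card_mono) auto
  moreover have "card ?A + card ?B = card (?A \<union> ?B) + card (?A \<inter> ?B)"
    by (intro card_Un_Int) auto
  moreover have "?A \<inter> ?B = {k. k < n \<and> (\<forall>i\<in>insert i I. P i k)}"
    by auto
  ultimately have "real (card ?A) + real (card ?B) \<le>
      real n + real (card {k. k < n \<and> (\<forall>i\<in>insert i I. P i k)})"
    by simp
  moreover have "(1 - \<epsilon>) * real n \<le> real (card ?A)"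
    using insert.prems by simp
  moreover have "(1 - real (card I) * \<epsilon>) * real n \<le> real (card ?B)"
    using insert.prems by (intro insert.IH) auto
  ultimately show ?case
    using insert.hyps by (simp add: algebra_simps)
qed simp

section \<open>Binary regular patterns and lower bounds on their densities\<close>

text \<open>For a fixed \<open>C\<close> each block has to show one prescribed symbol only. Both
  notions use the same binary test patterns, and marking \<open>\<sigma>\<close> commutes with
  masking and with taking hyperplanes, so regularity passes down the induction.\<close>

lemma regular_pattern_imp_binary:
  "regular_pattern \<epsilon> d ns X \<rho> \<Longrightarrow> binary_regular_pattern \<epsilon> d ns (\<lambda>\<alpha>. X \<alpha> = Some \<sigma>) (\<rho> \<sigma>)"
proof (induction \<epsilon> d ns X \<rho> rule: regular_pattern.induct)
  case (2 \<epsilon> ns X \<rho>)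
  then show ?case
    by (auto simp: density_def)
next
  case (3 \<epsilon> d ns X \<rho>)
  have mask: "(\<lambda>\<alpha>. mask L (hyperplane i k X) \<alpha> = Some \<sigma>) =
      (\<lambda>\<alpha>. L \<alpha> \<and> hyperplane i k (\<lambda>\<alpha>. X \<alpha> = Some \<sigma>) \<alpha>)" for L i k
    by (auto simp: mask_def hyperplane_def)
  show ?case
    unfolding binary_regular_pattern.simps
  proof (intro allI impI)
    fix i L \<rho>'
    assume i: "i < Suc (Suc d)"
      and L: "\<epsilon> \<le> \<rho>' \<and> \<rho>' \<le> 1 \<and> binary_regular_pattern \<epsilon> (Suc d) (delete_nth i ns) L \<rho>'"
    let ?n = "{k. k < ns ! i \<and> (\<exists>\<rho>''. (\<forall>\<sigma>. \<rho> \<sigma> * \<rho>' * (1 - \<epsilon>) \<le> \<rho>'' \<sigma>) \<and>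
      regular_pattern \<epsilon> (Suc d) (delete_nth i ns) (mask L (hyperplane i k X)) \<rho>'')}"
    let ?m = "{k. k < ns ! i \<and> (\<exists>\<rho>''. \<rho> \<sigma> * \<rho>' * (1 - \<epsilon>) \<le> \<rho>'' \<and>
      binary_regular_pattern \<epsilon> (Suc d) (delete_nth i ns)
        (\<lambda>\<alpha>. L \<alpha> \<and> hyperplane i k (\<lambda>\<alpha>. X \<alpha> = Some \<sigma>) \<alpha>) \<rho>'')}"
    have "(1 - \<epsilon>) * real (ns ! i) \<le> real (card ?n)"
      using 3(2) i L unfolding regular_pattern.simps by blast
    also have "card ?n \<le> card ?m"
      using 3(1)[OF i L] unfolding mask by (intro card_mono) fastforce+
    finally show "(1 - \<epsilon>) * real (ns ! i) \<le> real (card ?m)"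
      by simp
  qed
qed simp

text \<open>Test patterns must have density at most 1, which \<open>binary_regular_pattern\<close> does not enforce
  from dimension 2 on; hence the cap.\<close>

definition pattern_ge :: "real \<Rightarrow> nat \<Rightarrow> nat list \<Rightarrow> (nat list \<Rightarrow> bool) \<Rightarrow> real \<Rightarrow> bool" where
  "pattern_ge \<epsilon> d ns X r \<longleftrightarrow> (\<exists>\<rho>. r \<le> \<rho> \<and> \<rho> \<le> 1 \<and> binary_regular_pattern \<epsilon> d ns X \<rho>)"

lemma density_le_1: "density ns X s \<le> 1"
proof -
  have "card {\<alpha> \<in> indices ns. X \<alpha> = s} \<le> card (indices ns)"
    by (intro card_mono) auto
  then show ?thesis
    by (auto simp: density_def divide_le_eq_1 card_gt_0_iff)
qed

text \<open>From dimension 2 on the density enters only through a lower threshold, which may be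
  relaxed. In dimension 1 it is an exact value, hence the form \<open>Suc (Suc d)\<close>.\<close>

lemma binary_regular_pattern_antimono:
  assumes "0 < \<epsilon>" "\<epsilon> < 1" "\<rho>\<^sub>0 \<le> \<rho>"
    and "binary_regular_pattern \<epsilon> (Suc (Suc d)) ns X \<rho>"
  shows "binary_regular_pattern \<epsilon> (Suc (Suc d)) ns X \<rho>\<^sub>0"
  unfolding binary_regular_pattern.simps
proof (intro allI impI)
  fix i L \<rho>'
  assume i: "i < Suc (Suc d)"
    and L: "\<epsilon> \<le> \<rho>' \<and> \<rho>' \<le> 1 \<and> binary_regular_pattern \<epsilon> (Suc d) (delete_nth i ns) L \<rho>'"
  let ?K = "\<lambda>\<rho>. {k. k < ns ! i \<and> (\<exists>\<rho>''. \<rho> * \<rho>' * (1 - \<epsilon>) \<le> \<rho>'' \<and>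
    binary_regular_pattern \<epsilon> (Suc d) (delete_nth i ns)
      (\<lambda>\<alpha>. L \<alpha> \<and> hyperplane i k X \<alpha>) \<rho>'')}"
  \<comment> \<open>Test densities satisfy \<open>\<rho>' \<ge> \<epsilon> > 0\<close>, so the
    threshold is monotone in the density.\<close>
  have "\<rho>\<^sub>0 * \<rho>' * (1 - \<epsilon>) \<le> \<rho> * \<rho>' * (1 - \<epsilon>)"
    using assms L by (intro mult_right_mono) auto
  then have "?K \<rho> \<subseteq> ?K \<rho>\<^sub>0"
    using order_trans by blast
  then have "card (?K \<rho>) \<le> card (?K \<rho>\<^sub>0)"
    by (intro card_mono) auto
  moreover have "(1 - \<epsilon>) * real (ns ! i) \<le> real (card (?K \<rho>))"
    using assms(4) i L unfolding binary_regular_pattern.simps by blast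
  ultimately show "(1 - \<epsilon>) * real (ns ! i) \<le> real (card (?K \<rho>\<^sub>0))"
    by linarith
qed

text \<open>In dimension 1 the density is a fraction, so the cap holds by itself; from dimension 2
  on the density is lowered to \<open>r\<close>.\<close>

lemma pattern_geI:
  assumes "0 < \<epsilon>" "\<epsilon> < 1" "r \<le> \<rho>" "r \<le> 1"
    and "binary_regular_pattern \<epsilon> (Suc d) ns X \<rho>"
  shows "pattern_ge \<epsilon> (Suc d) ns X r"
proof (cases d)
  case 0
  then show ?thesis
    using assms density_le_1 unfolding pattern_ge_def by auto
next
  case (Suc d')
  then have "binary_regular_pattern \<epsilon> (Suc d) ns X r"
    using assms binary_regular_pattern_antimono by blast
  then show ?thesis
    using assms(4) unfolding pattern_ge_def by blast
qed

lemma pattern_ge_le_1: "pattern_ge \<epsilon> d ns X r \<Longrightarrow> r \<le> 1"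
  by (auto simp: pattern_ge_def)

lemma pattern_ge_density:
  assumes "pattern_ge \<epsilon> (Suc 0) [n] X r" "0 < n"
  shows "r * real n \<le> real (card {k. k < n \<and> X [k]})"
proof -
  have "{\<alpha> \<in> indices [n]. X \<alpha>} = (\<lambda>k. [k]) ` {k. k < n \<and> X [k]}"
    and "indices [n] = (\<lambda>k. [k]) ` {..<n}"
    by (auto simp: indices_Cons)
  then have "density [n] X True = real (card {k. k < n \<and> X [k]}) / real n"
    by (simp add: density_def card_image inj_on_def)
  then have "real (card {k. k < n \<and> X [k]}) = density [n] X True * real n"
    using assms(2) by simp
  then show ?thesis
    using assms(1) by (auto simp: pattern_ge_def intro: mult_right_mono)
qed

text \<open>The empty product of hyperplanes, with which the multiplication starts. From dimension 2
  on, multiplying \<open>L\<close> by an all-ones hyperplane returns \<open>L\<close>, so no density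
  is lost.\<close>

lemma pattern_ge_True:
  assumes "0 < \<epsilon>" "\<epsilon> < 1" "length ns = Suc d" "\<forall>n\<in>set ns. 0 < n"
  shows "pattern_ge \<epsilon> (Suc d) ns (\<lambda>_. True) 1"
proof (cases d)
  case 0
  then obtain n where "ns = [n]" "0 < n"
    using assms(3,4) by (auto simp: length_Suc_conv)
  \<comment> \<open>An empty index set would have density 0 / 0 = 0 instead of 1; positive sizes
    exclude this.\<close>
  then have "[0] \<in> indices ns"
    by simp
  then have "card (indices ns) \<noteq> 0"
    by (metis card_eq_0_iff emptyE finite_indices)
  then show ?thesis
    using 0 by (simp add: pattern_ge_def density_def)
next
  case (Suc d')
  have "binary_regular_pattern \<epsilon> (Suc d) ns (\<lambda>_. True) 1"
    unfolding Suc binary_regular_pattern.simps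
  proof (intro allI impI)
    fix i L \<rho>'
    assume L: "\<epsilon> \<le> \<rho>' \<and> \<rho>' \<le> 1 \<and> binary_regular_pattern \<epsilon> (Suc d') (delete_nth i ns) L \<rho>'"
    have "1 * \<rho>' * (1 - \<epsilon>) \<le> \<rho>'"
      using L assms mult_left_le[of "1 - \<epsilon>" \<rho>'] by simp
    then have "{k. k < ns ! i \<and> (\<exists>\<rho>''. 1 * \<rho>' * (1 - \<epsilon>) \<le> \<rho>'' \<and>
        binary_regular_pattern \<epsilon> (Suc d') (delete_nth i ns)
          (\<lambda>\<alpha>. L \<alpha> \<and> hyperplane i k (\<lambda>_. True) \<alpha>) \<rho>'')} = {..<ns ! i}"
      using L by (auto simp: hyperplane_def)
    then show "(1 - \<epsilon>) * real (ns ! i) \<le> real (card {k. k < ns ! i \<and>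
        (\<exists>\<rho>''. 1 * \<rho>' * (1 - \<epsilon>) \<le> \<rho>'' \<and> binary_regular_pattern \<epsilon> (Suc d') (delete_nth i ns)
          (\<lambda>\<alpha>. L \<alpha> \<and> hyperplane i k (\<lambda>_. True) \<alpha>) \<rho>'')})"
      using assms by (simp add: mult_left_le_one_le)
  qed
  then show ?thesis
    by (auto simp: pattern_ge_def)
qed

section \<open>Multiplying hyperplanes along one coordinate\<close>

text \<open>This is regularity of \<open>R\<close> in direction 0, tested with \<open>L\<close>. The
  product is again a \<open>pattern_ge\<close>, so it can be the next test pattern as long as its
  bound stays at least \<open>\<epsilon>\<close>.\<close>

lemma pattern_ge_hyperplanes:
  assumes \<epsilon>: "0 < \<epsilon>" "\<epsilon> < 1"
    and R: "pattern_ge \<epsilon> (Suc (Suc d)) (n # ns) R r" "0 \<le> r"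
    and L: "pattern_ge \<epsilon> (Suc d) ns L s" "\<epsilon> \<le> s"
  shows "(1 - \<epsilon>) * real n \<le>
    real (card {k. k < n \<and> pattern_ge \<epsilon> (Suc d) ns (\<lambda>\<alpha>. L \<alpha> \<and> R (k # \<alpha>)) (s * r * (1 - \<epsilon>))})"
proof -
  obtain \<rho> where \<rho>: "r \<le> \<rho>" "\<rho> \<le> 1" "binary_regular_pattern \<epsilon> (Suc (Suc d)) (n # ns) R \<rho>"
    using R by (auto simp: pattern_ge_def)
  obtain \<rho>' where \<rho>': "s \<le> \<rho>'" "\<rho>' \<le> 1" "binary_regular_pattern \<epsilon> (Suc d) ns L \<rho>'"
    using L by (auto simp: pattern_ge_def)
  have del: "delete_nth 0 (n # ns) = ns" and hyp: "hyperplane 0 k R = (\<lambda>\<alpha>. R (k # \<alpha>))" for k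
    by (simp_all add: delete_nth_def hyperplane_def)
  let ?K = "{k. k < n \<and> (\<exists>\<rho>''. \<rho> * \<rho>' * (1 - \<epsilon>) \<le> \<rho>'' \<and>
    binary_regular_pattern \<epsilon> (Suc d) ns (\<lambda>\<alpha>. L \<alpha> \<and> R (k # \<alpha>)) \<rho>'')}"
  have "\<epsilon> \<le> \<rho>'"
    using L \<rho>' by simp
  with \<rho>(3)[unfolded binary_regular_pattern.simps, rule_format, of 0 \<rho>' L] \<rho>'
  have K: "(1 - \<epsilon>) * real n \<le> real (card ?K)"
    by (simp add: del hyp)
  have "s * r \<le> \<rho>' * \<rho>"
    using \<rho> \<rho>' L R \<epsilon> by (intro mult_mono) auto
  moreover have "\<rho>' * \<rho> \<le> 1"
    using \<rho> \<rho>' R L \<epsilon> by (intro mult_le_one) auto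
  ultimately have le: "s * r * (1 - \<epsilon>) \<le> \<rho> * \<rho>' * (1 - \<epsilon>)" "s * r * (1 - \<epsilon>) \<le> 1"
    using \<epsilon> R L mult_le_one[of "s * r" "1 - \<epsilon>"] by (auto simp: mult.commute intro: mult_left_mono)
  have "?K \<subseteq> {k. k < n \<and> pattern_ge \<epsilon> (Suc d) ns (\<lambda>\<alpha>. L \<alpha> \<and> R (k # \<alpha>)) (s * r * (1 - \<epsilon>))}"
    using pattern_geI[OF \<epsilon> order_trans[OF le(1)] le(2)] by blast
  then have "card ?K \<le>
      card {k. k < n \<and> pattern_ge \<epsilon> (Suc d) ns (\<lambda>\<alpha>. L \<alpha> \<and> R (k # \<alpha>)) (s * r * (1 - \<epsilon>))}"
    by (intro card_mono) auto
  with K show ?thesis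
    by linarith
qed

text \<open>All positions \<open>i\<close> share the index chosen in part \<open>b\<close>, so it
  must be good for each of them; by the union bound this costs a factor
  \<open>1 - card I * \<epsilon>\<close> per part. Asking for a bound of at least
  \<open>\<epsilon>\<close> at the end suffices, since the bounds only decrease along the
  way.\<close>

lemma pattern_ge_hyperplane_tuples:
  fixes ns :: "'i \<Rightarrow> nat list"
  assumes \<epsilon>: "0 < \<epsilon>" "\<epsilon> < 1" and I: "finite I" "real (card I) * \<epsilon> \<le> 1"
    and R: "\<And>b i. b < length ms \<Longrightarrow> i \<in> I \<Longrightarrow>
      pattern_ge \<epsilon> (Suc (Suc d)) (ms ! b # ns i) (R b i) (r b i) \<and> 0 \<le> r b i"
    and L: "\<And>i. i \<in> I \<Longrightarrow> pattern_ge \<epsilon> (Suc d) (ns i) (L i) (s i)"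
    and s: "\<And>i. i \<in> I \<Longrightarrow> \<epsilon> \<le> s i * (\<Prod>b<length ms. r b i * (1 - \<epsilon>))"
  shows "(1 - real (card I) * \<epsilon>) ^ length ms * real (prod_list ms) \<le>
    real (card {xs \<in> indices ms. \<forall>i\<in>I. pattern_ge \<epsilon> (Suc d) (ns i)
      (\<lambda>\<alpha>. L i \<alpha> \<and> (\<forall>b < length ms. R b i (xs ! b # \<alpha>)))
      (s i * (\<Prod>b<length ms. r b i * (1 - \<epsilon>)))})"
  using R L s
proof (induction ms arbitrary: R r L s)
  case Nil
  then have "{xs :: nat list. xs = [] \<and> (\<forall>i\<in>I. pattern_ge \<epsilon> (Suc d) (ns i) (L i) (s i))} = {[]}"
    by auto
  then show ?case
    by simp
next
  case (Cons m ms)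
  note R = Cons.prems(1) and L = Cons.prems(2) and s = Cons.prems(3)
  \<comment> \<open>\<open>?s\<close> bounds the density after the first hyperplane,
    \<open>?p\<close> collects the factors still to come.\<close>
  let ?s = "\<lambda>i. s i * r 0 i * (1 - \<epsilon>)"
  let ?p = "\<lambda>i. \<Prod>b<length ms. r (Suc b) i * (1 - \<epsilon>)"
  let ?L = "\<lambda>k i \<alpha>. L i \<alpha> \<and> R 0 i (k # \<alpha>)"
  let ?G = "{k. k < m \<and> (\<forall>i\<in>I. pattern_ge \<epsilon> (Suc d) (ns i) (?L k i) (?s i))}"
  let ?T = "\<lambda>k. {xs \<in> indices ms. \<forall>i\<in>I. pattern_ge \<epsilon> (Suc d) (ns i)
      (\<lambda>\<alpha>. ?L k i \<alpha> \<and> (\<forall>b < length ms. R (Suc b) i (xs ! b # \<alpha>))) (?s i * ?p i)}"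
  have sp: "s i * (\<Prod>b<length (m # ms). r b i * (1 - \<epsilon>)) = ?s i * ?p i" for i
    by (simp add: prod.lessThan_Suc_shift mult_ac del: prod.lessThan_Suc)
  \<comment> \<open>The remaining factors lie in [0, 1], so a final bound of at least
    \<open>\<epsilon>\<close> forces \<open>s i \<ge> \<epsilon>\<close>; a negative
    \<open>s i\<close> would make the final bound nonpositive.\<close>
  have s\<epsilon>: "\<epsilon> \<le> s i" if i: "i \<in> I" for i
  proof -
    let ?q = "\<Prod>b<length (m # ms). r b i * (1 - \<epsilon>)"
    have "0 \<le> r b i" "r b i \<le> 1" if "b < length (m # ms)" for b
      using R[OF that i] pattern_ge_le_1 by auto
    then have q: "0 \<le> ?q" "?q \<le> 1"
      using \<epsilon> by (intro prod_nonneg prod_le_1 conjI mult_nonneg_nonneg mult_le_one; force)+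
    have "\<epsilon> \<le> s i * ?q" using s i by blast
    moreover have "0 \<le> s i"
    proof (rule ccontr)
      assume "\<not> 0 \<le> s i"
      then have "s i * ?q \<le> 0" using q by (intro mult_nonpos_nonneg) auto
      then show False using calculation \<epsilon> by linarith
    qed
    ultimately show ?thesis
      using q mult_left_le[of ?q "s i"] by linarith
  qed
  have "(1 - \<epsilon>) * real m \<le> real (card {k. k < m \<and> pattern_ge \<epsilon> (Suc d) (ns i) (?L k i) (?s i)})"
    if "i \<in> I" for i
    using R[of 0 i] that by (intro pattern_ge_hyperplanes \<epsilon> L s\<epsilon>) auto
  then have G: "(1 - real (card I) * \<epsilon>) * real m \<le> real (card ?G)"
    by (intro card_all_ge I)
  have "(1 - real (card I) * \<epsilon>) ^ length ms * real (prod_list ms) \<le> real (card (?T k))"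
    if "k \<in> ?G" for k
  proof (rule Cons.IH)
    show "pattern_ge \<epsilon> (Suc (Suc d)) (ms ! b # ns i) (R (Suc b) i) (r (Suc b) i) \<and> 0 \<le> r (Suc b) i"
      if "b < length ms" "i \<in> I" for b i
      using R[of "Suc b" i] that by simp
    show "pattern_ge \<epsilon> (Suc d) (ns i) (?L k i) (?s i)" if "i \<in> I" for i
      using \<open>k \<in> ?G\<close> that by blast
    show "\<epsilon> \<le> ?s i * ?p i" if "i \<in> I" for i
      using s[OF that] unfolding sp .
  qed
  then have "real (card ?G) * ((1 - real (card I) * \<epsilon>) ^ length ms * real (prod_list ms)) \<le>
      real (card {xs \<in> indices (m # ms). \<forall>i\<in>I. pattern_ge \<epsilon> (Suc d) (ns i)
      (\<lambda>\<alpha>. L i \<alpha> \<and> (\<forall>b < length (m # ms). R b i (xs ! b # \<alpha>)))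
      (s i * (\<Prod>b<length (m # ms). r b i * (1 - \<epsilon>)))})"
    unfolding sp by (rule card_Cons_ge[rotated 4]) (auto simp: All_less_Suc2 conj_assoc)
  moreover have "(1 - real (card I) * \<epsilon>) * real m *
      ((1 - real (card I) * \<epsilon>) ^ length ms * real (prod_list ms)) \<le>
      real (card ?G) * ((1 - real (card I) * \<epsilon>) ^ length ms * real (prod_list ms))"
    using I G by (intro mult_right_mono) auto
  ultimately show ?case
    by (simp add: mult_ac)
qed


section \<open>Choosing indices in all coordinates\<close>

text \<open>Per coordinate with \<open>t\<close> parts and \<open>N\<close> positions of the remaining coordinates, \<open>t N\<close> factors
  \<open>1 - \<epsilon>\<close> are lost in the densities and \<open>t\<close> factors \<open>1 - N \<epsilon>\<close> in the choice of indices; the extra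
  \<open>N\<close> ensures \<open>N \<epsilon> \<le> 1\<close> also for \<open>t = 0\<close>.\<close>

primrec loss :: "nat list \<Rightarrow> nat" where
  "loss [] = 0"
| "loss (t # ts) = (2 * t + 1) * card (indices ts) + loss ts"

lemma in_listset_iff:
  "xs \<in> listset As \<longleftrightarrow> length xs = length As \<and> (\<forall>j < length As. xs ! j \<in> As ! j)"
proof (induction As arbitrary: xs)
  case (Cons A As)
  then show ?case
    by (cases xs) (auto simp: set_Cons_def All_less_Suc2)
qed auto

lemma finite_listset: "\<forall>A\<in>set As. finite A \<Longrightarrow> finite (listset As)"
proof (induction As)
  case (Cons A As)
  have "set_Cons A (listset As) = (\<lambda>(x, xs). x # xs) ` (A \<times> listset As)"
    by (auto simp: set_Cons_def)
  with Cons show ?case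
    by simp
qed simp

lemma finite_listset_indices [simp]: "finite (listset (map indices mss))"
  by (rule finite_listset) auto

lemma one_minus_mult_le:
  fixes x :: real
  assumes "0 \<le> x" "0 \<le> y"
  shows "1 - (x + y) \<le> (1 - x) * (1 - y)"
  using mult_nonneg_nonneg[OF assms] by (simp add: algebra_simps)

lemma one_minus_power_ge:
  fixes x :: real
  assumes "x \<le> 1"
  shows "1 - real n * x \<le> (1 - x) ^ n"
  using Bernoulli_inequality[of "- x" n] assms by simp

text \<open>\<open>mss\<close> holds the part sizes, one list per coordinate, and \<open>xss\<close>
  the chosen indices, numbered within their parts. \<open>Q\<close> and \<open>r\<close> vary in the
  induction because fixing the first coordinate replaces blocks by products of hyperplanes with
  smaller density bounds. The last hypothesis keeps these bounds at least
  \<open>\<epsilon>\<close>.\<close>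

lemma count_blockwise:
  assumes \<epsilon>: "0 < \<epsilon>" "\<epsilon> < 1" and "mss \<noteq> []"
    and "\<forall>ms\<in>set mss. \<forall>m\<in>set ms. 0 < m"
    and "\<forall>\<beta>\<in>indices (map length mss).
      pattern_ge \<epsilon> (length mss) (map2 (!) mss \<beta>) (Q \<beta>) (r \<beta>) \<and> 0 < r \<beta>"
    and "\<epsilon> \<le> (\<Prod>\<beta>\<in>indices (map length mss). r \<beta>) * (1 - real (loss (map length mss)) * \<epsilon>)"
  shows "(1 - real (loss (map length mss)) * \<epsilon>) * real (\<Prod>ms\<leftarrow>mss. prod_list ms) *
      (\<Prod>\<beta>\<in>indices (map length mss). r \<beta>) \<le>
    real (card {xss \<in> listset (map indices mss).
      \<forall>\<beta>\<in>indices (map length mss). Q \<beta> (map2 (!) xss \<beta>)})"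
  using assms(3-6)
proof (induction mss arbitrary: Q r rule: list_nonempty_induct)
  case (single ms)
  have r: "0 < r [b]" "r [b] * real (ms ! b) \<le> real (card {k. k < ms ! b \<and> Q [b] [k]})"
    if "b < length ms" for b
    using single that by (auto simp: indices_Cons intro!: pattern_ge_density)
  have Ball_indices: "(\<forall>\<beta>\<in>indices [n]. R \<beta>) \<longleftrightarrow> (\<forall>b<n. R [b])" for n R
    by (auto simp: indices_Cons)
  have inj_singleton: "inj (\<lambda>xs :: nat list. [xs])"
    by (simp add: inj_on_def)
  have "{xss \<in> listset (map indices [ms]).
      \<forall>\<beta>\<in>indices (map length [ms]). Q \<beta> (map2 (!) xss \<beta>)} =
      (\<lambda>xs. [xs]) ` {xs \<in> indices ms. \<forall>b < length ms. Q [b] [xs ! b]}"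
    by (auto simp: set_Cons_def Ball_indices)
  then have card: "card {xss \<in> listset (map indices [ms]).
      \<forall>\<beta>\<in>indices (map length [ms]). Q \<beta> (map2 (!) xss \<beta>)} =
      (\<Prod>b<length ms. card {k. k < ms ! b \<and> Q [b] [k]})"
    by (simp only: card_image[OF inj_on_subset[OF inj_singleton subset_UNIV]]
        card_indices_all_nth[of ms "\<lambda>b k. Q [b] [k]"])
  have "(\<Prod>b<length ms. r [b] * real (ms ! b)) \<le>
      (\<Prod>b<length ms. real (card {k. k < ms ! b \<and> Q [b] [k]}))"
    using r by (intro prod_mono) (simp add: less_imp_le)
  moreover have "(\<Prod>b<length ms. r [b] * real (ms ! b)) =
      real (prod_list ms) * (\<Prod>b<length ms. r [b])"
    by (simp add: prod.distrib prod.list_conv_set_nth atLeast0LessThan)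
  \<comment> \<open>Dimension 1 is lossless: the factor containing \<open>loss\<close> is simply
    bounded by 1.\<close>
  moreover have "0 \<le> real (prod_list ms) * (\<Prod>b<length ms. r [b])"
    using r by (intro mult_nonneg_nonneg prod_nonneg) (auto intro: less_imp_le)
  then have "(1 - real (loss [length ms]) * \<epsilon>) * (real (prod_list ms) * (\<Prod>b<length ms. r [b])) \<le>
      1 * (real (prod_list ms) * (\<Prod>b<length ms. r [b]))"
    using \<epsilon> by (intro mult_right_mono) auto
  ultimately show ?case
    unfolding card by (simp add: prod_indices_Cons mult.assoc)
next
  case (cons ms mss)
  obtain d where d: "length mss = Suc d"
    using cons(1) by (cases mss) auto
  define t where "t = length ms"
  define ts where "ts = map length mss"
  define I where "I = indices ts"
  define N where "N = card I"
  define K where "K = loss ts"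
  define p where "p = (\<Prod>\<beta>\<in>indices (t # ts). r \<beta>)"
  \<comment> \<open>The density bound at position \<open>\<alpha>\<close> once the \<open>t\<close>
    hyperplanes from the blocks \<open>b # \<alpha>\<close> are multiplied.\<close>
  define s where "s = (\<lambda>\<alpha>. \<Prod>b<t. r (b # \<alpha>) * (1 - \<epsilon>))"
  have Q: "pattern_ge \<epsilon> (Suc (Suc d)) (ms ! b # map2 (!) mss \<alpha>) (Q (b # \<alpha>)) (r (b # \<alpha>))"
    "0 < r (b # \<alpha>)" if "b < t" "\<alpha> \<in> I" for b \<alpha>
    using bspec[OF cons.prems(2), of "b # \<alpha>"] that by (auto simp: t_def ts_def I_def d)
  have r: "0 < r \<beta> \<and> r \<beta> \<le> 1" if "\<beta> \<in> indices (t # ts)" for \<beta>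
    using Q that pattern_ge_le_1 by (fastforce simp: indices_Cons I_def)
  have p: "0 < p" "p \<le> 1"
    unfolding p_def using r by (simp_all add: prod_pos prod_le_1 less_imp_le)
  have loss: "loss (map length (ms # mss)) = (2 * t + 1) * N + K"
    by (simp add: t_def N_def I_def K_def ts_def)
  have \<epsilon>p: "\<epsilon> \<le> p * (1 - real ((2 * t + 1) * N + K) * \<epsilon>)"
    using cons.prems(3) unfolding loss by (simp add: p_def t_def ts_def)
  \<comment> \<open>A positive number is at most \<open>p\<close> times this factor, and
    \<open>p > 0\<close>. The nonnegativity of the smaller error factors below follows.\<close>
  have pos: "0 < 1 - real ((2 * t + 1) * N + K) * \<epsilon>"
    using less_le_trans[OF \<epsilon>(1) \<epsilon>p] p(1) by (rule zero_less_mult_pos)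
  have N\<epsilon>: "real N * \<epsilon> \<le> 1" and K\<epsilon>: "real K * \<epsilon> \<le> 1"
  proof -
    have "real N * \<epsilon> \<le> real ((2 * t + 1) * N + K) * \<epsilon>" "real K * \<epsilon> \<le> real ((2 * t + 1) * N + K) * \<epsilon>"
      using \<epsilon> by (intro mult_right_mono of_nat_mono; simp)+
    with pos show "real N * \<epsilon> \<le> 1" "real K * \<epsilon> \<le> 1"
      by linarith+
  qed
  have s_pos: "0 < s \<alpha>" and s_le: "s \<alpha> \<le> 1" if "\<alpha> \<in> I" for \<alpha>
  proof -
    have "0 < r (b # \<alpha>) * (1 - \<epsilon>)" "r (b # \<alpha>) * (1 - \<epsilon>) \<le> 1" if "b < t" for b
      using \<epsilon> r[of "b # \<alpha>"] that \<open>\<alpha> \<in> I\<close> by (auto simp: I_def intro: mult_le_one)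
    then show "0 < s \<alpha>" "s \<alpha> \<le> 1"
      unfolding s_def by (auto intro: prod_pos prod_le_1 dest: less_imp_le)
  qed
  have prod_s: "(\<Prod>\<alpha>\<in>I. s \<alpha>) = p * (1 - \<epsilon>) ^ (t * N)"
    by (simp add: s_def p_def prod_indices_Cons I_def N_def prod.distrib power_mult)
  have tN: "1 - real (t * N) * \<epsilon> \<le> (1 - \<epsilon>) ^ (t * N)"
    using \<epsilon> by (intro one_minus_power_ge) auto
  \<comment> \<open>The density condition is transferred to the remaining coordinates: by Bernoulli
    the \<open>t * N\<close> factors \<open>1 - \<epsilon>\<close> cost at most
    \<open>t * N * \<epsilon>\<close>.\<close>
  have "p * (1 - real ((2 * t + 1) * N + K) * \<epsilon>) \<le> p * (1 - real (t * N + K) * \<epsilon>)"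
    using p \<epsilon> by (intro mult_left_mono diff_mono mult_right_mono) auto
  also have "\<dots> \<le> p * ((1 - real (t * N) * \<epsilon>) * (1 - real K * \<epsilon>))"
    using p \<epsilon> one_minus_mult_le[of "real (t * N) * \<epsilon>" "real K * \<epsilon>"]
    by (intro mult_left_mono) (auto simp: algebra_simps)
  also have "\<dots> \<le> p * ((1 - \<epsilon>) ^ (t * N) * (1 - real K * \<epsilon>))"
    using p tN K\<epsilon> by (intro mult_left_mono mult_right_mono) auto
  finally have \<epsilon>s: "\<epsilon> \<le> (\<Prod>\<alpha>\<in>I. s \<alpha>) * (1 - real K * \<epsilon>)"
    unfolding prod_s using \<epsilon>p by (simp add: mult.assoc)
  have s_ge: "\<epsilon> \<le> s \<alpha>" if "\<alpha> \<in> I" for \<alpha>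
  proof -
    \<comment> \<open>The other factors are at most 1, so each single \<open>s \<alpha>\<close> is
      at least the whole product.\<close>
    have "(\<Prod>\<alpha>\<in>I. s \<alpha>) = s \<alpha> * (\<Prod>\<alpha>\<in>I - {\<alpha>}. s \<alpha>)"
      using that by (intro prod.remove) (simp_all add: I_def)
    moreover have "(\<Prod>\<alpha>\<in>I - {\<alpha>}. s \<alpha>) \<le> 1"
      using s_pos s_le by (intro prod_le_1) (auto intro: less_imp_le)
    ultimately have "(\<Prod>\<alpha>\<in>I. s \<alpha>) \<le> s \<alpha>"
      using s_pos[OF that] by (simp add: mult_left_le)
    moreover have "(\<Prod>\<alpha>\<in>I. s \<alpha>) * (1 - real K * \<epsilon>) \<le> (\<Prod>\<alpha>\<in>I. s \<alpha>)"
      using s_pos \<epsilon> K\<epsilon> by (intro mult_left_le prod_nonneg) (auto intro: less_imp_le)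
    ultimately show ?thesis
      using \<epsilon>s by linarith
  qed
  \<comment> \<open>\<open>?L xs \<beta>\<close> is the product of the hyperplanes cut out by
    \<open>xs\<close> at position \<open>\<beta>\<close>, \<open>?G\<close> the choices keeping all
    these products dense, \<open>?T xs\<close> the valid completions of \<open>xs\<close>.\<close>
  let ?L = "\<lambda>xs \<beta> \<alpha>. \<forall>b<t. Q (b # \<beta>) (xs ! b # \<alpha>)"
  let ?G = "{xs \<in> indices ms. \<forall>\<beta>\<in>I. pattern_ge \<epsilon> (Suc d) (map2 (!) mss \<beta>) (?L xs \<beta>) (s \<beta>)}"
  let ?T = "\<lambda>xs. {xss \<in> listset (map indices mss). \<forall>\<beta>\<in>I. ?L xs \<beta> (map2 (!) xss \<beta>)}"
  have "pattern_ge \<epsilon> (Suc d) (map2 (!) mss \<beta>) (\<lambda>_. True) 1" if "\<beta> \<in> I" for \<beta>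
    using that cons.prems(1) d
    by (intro pattern_ge_True \<epsilon>) (auto simp: I_def ts_def indices_def all_set_conv_all_nth)
  then have "(1 - real N * \<epsilon>) ^ t * real (prod_list ms) \<le> real (card ?G)"
    using pattern_ge_hyperplane_tuples[of \<epsilon> I ms d "map2 (!) mss" "\<lambda>b \<beta>. Q (b # \<beta>)"
        "\<lambda>b \<beta>. r (b # \<beta>)" "\<lambda>_ _. True" "\<lambda>_. 1"] \<epsilon> N\<epsilon> Q s_ge
    by (simp add: I_def t_def N_def s_def less_imp_le)
  moreover have "1 - real (t * N) * \<epsilon> \<le> (1 - real N * \<epsilon>) ^ t"
    using one_minus_power_ge[of "real N * \<epsilon>" t] N\<epsilon> by (simp add: mult.assoc)
  ultimately have G: "(1 - real (t * N) * \<epsilon>) * real (prod_list ms) \<le> real (card ?G)"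
    by (meson mult_right_mono of_nat_0_le_iff order_trans)
  define M where "M = real (\<Prod>ms\<leftarrow>mss. prod_list ms)"
  have "(1 - real K * \<epsilon>) * M * (\<Prod>\<beta>\<in>I. s \<beta>) \<le> real (card (?T xs))" if "xs \<in> ?G" for xs
    unfolding K_def M_def I_def ts_def
  \<comment> \<open>The products \<open>?L xs\<close> with bounds \<open>s\<close> are the blocks of
    an instance in one dimension less.\<close>
  proof (rule cons.IH)
    show "\<forall>ms\<in>set mss. \<forall>m\<in>set ms. 0 < m"
      using cons.prems(1) by simp
    show "\<forall>\<beta>\<in>indices (map length mss).
        pattern_ge \<epsilon> (length mss) (map2 (!) mss \<beta>) (?L xs \<beta>) (s \<beta>) \<and> 0 < s \<beta>"
      using that s_pos by (simp add: d I_def ts_def)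
    show "\<epsilon> \<le> (\<Prod>\<beta>\<in>indices (map length mss). s \<beta>) * (1 - real (loss (map length mss)) * \<epsilon>)"
      using \<epsilon>s by (simp add: I_def K_def ts_def)
  qed
  moreover have "finite {xss \<in> listset (map indices (ms # mss)).
      \<forall>\<beta>\<in>indices (map length (ms # mss)). Q \<beta> (map2 (!) xss \<beta>)}"
    by (rule finite_subset[OF _ finite_listset_indices[of "ms # mss"]]) blast
  ultimately have card: "real (card ?G) * ((1 - real K * \<epsilon>) * M * (\<Prod>\<beta>\<in>I. s \<beta>)) \<le>
      real (card {xss \<in> listset (map indices (ms # mss)).
        \<forall>\<beta>\<in>indices (map length (ms # mss)). Q \<beta> (map2 (!) xss \<beta>)})"
    by (intro card_Cons_ge[where T = ?T])
      (auto simp: set_Cons_def indices_Cons I_def ts_def t_def)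
  define D where "D = (1 - real K * \<epsilon>) * M * p"
  have D: "0 \<le> D"
    unfolding D_def M_def using K\<epsilon> p by (intro mult_nonneg_nonneg) auto
  let ?a = "1 - real (t * N) * \<epsilon>"
  have a: "0 \<le> ?a"
  proof -
    have "real (t * N) * \<epsilon> \<le> real ((2 * t + 1) * N + K) * \<epsilon>"
      using \<epsilon> by (intro mult_right_mono of_nat_mono) auto
    with pos show ?thesis by linarith
  qed
  \<comment> \<open>The error splits into \<open>t * N\<close> for choosing indices,
    \<open>t * N\<close> for the densities and \<open>K\<close> for the remaining coordinates; the
    spare \<open>N\<close> is dropped.\<close>
  have "1 - real ((2 * t + 1) * N + K) * \<epsilon> \<le> 1 - (real (t * N) * \<epsilon> + real (t * N) * \<epsilon> + real K * \<epsilon>)"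
    using \<epsilon> by (simp add: algebra_simps)
  also have "\<dots> \<le> (1 - (real (t * N) * \<epsilon> + real (t * N) * \<epsilon>)) * (1 - real K * \<epsilon>)"
    using \<epsilon> by (intro one_minus_mult_le) auto
  also have "\<dots> \<le> ?a * ?a * (1 - real K * \<epsilon>)"
    using \<epsilon> K\<epsilon> by (intro mult_right_mono one_minus_mult_le) auto
  finally have "(1 - real ((2 * t + 1) * N + K) * \<epsilon>) * (real (prod_list ms) * M * p) \<le>
      ?a * ?a * (1 - real K * \<epsilon>) * (real (prod_list ms) * M * p)"
    using p by (intro mult_right_mono) (auto simp: M_def)
  also have "\<dots> = ?a * real (prod_list ms) * (?a * D)"
    by (simp add: D_def)
  also have "\<dots> \<le> real (card ?G) * ((1 - \<epsilon>) ^ (t * N) * D)"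
    using G D a tN by (intro mult_mono mult_nonneg_nonneg) auto
  also have "\<dots> = real (card ?G) * ((1 - real K * \<epsilon>) * M * (\<Prod>\<beta>\<in>I. s \<beta>))"
    by (simp add: prod_s D_def)
  finally show ?case
    using card unfolding loss by (simp add: M_def p_def t_def ts_def mult_ac)
qed

section \<open>From choices of indices to submatrices\<close>

text \<open>A choice determines the submatrix on all chosen indices. Parts need not be intervals, so
  sorting may mix their order; permuting hyperplanes of \<open>C\<close> compensates. Distinct
  choices give distinct index sets since the parts are disjoint.\<close>

lemma choices_le_appearances:
  fixes ts m
  defines "mss \<equiv> map (\<lambda>j. map (m j) [0..<ts ! j]) [0..<length ts]"
  assumes part: "block_partition ns ts m P"
  shows "card {xss \<in> listset (map indices mss).
      \<forall>\<beta>\<in>indices ts. block A P \<beta> (map2 (!) xss \<beta>) = C \<beta>} \<le> appearances ts C ns A"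
proof -
  let ?X = "{xss \<in> listset (map indices mss).
      \<forall>\<beta>\<in>indices ts. block A P \<beta> (map2 (!) xss \<beta>) = C \<beta>}"
  let ?app = "{S. length S = length ns \<and>
     (\<forall>j < length ns. S ! j \<subseteq> {..<ns ! j} \<and> card (S ! j) = ts ! j) \<and>
     (\<exists>\<pi>. (\<forall>j < length ts. \<pi> j permutes {..<ts ! j}) \<and>
        (\<forall>\<beta> \<in> indices ts.
           submatrix A S \<beta> = C (map (\<lambda>j. \<pi> j (\<beta> ! j)) [0..<length \<beta>])))}"
  \<comment> \<open>Translates an index numbered within a part into an index of
    \<open>A\<close>.\<close>
  define y where "y = (\<lambda>xss j b. sorted_list_of_set (P j b) ! (xss ! j ! b :: nat))"
  define S where "S = (\<lambda>xss. map (\<lambda>j. y xss j ` {..<ts ! j}) [0..<length ts])"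
  have len: "length ns = length ts"
    using part by (simp add: block_partition_def)
  have P: "P j b \<subseteq> {..<ns ! j}" "finite (P j b)" "card (P j b) = m j b"
    if "j < length ts" "b < ts ! j" for j b
  proof -
    have "\<Union> (P j ` {..<ts ! j}) = {..<ns ! j}"
      using part that by (simp add: block_partition_def partition_on_def)
    then show "P j b \<subseteq> {..<ns ! j}"
      using that by blast
    then show "finite (P j b)"
      using finite_subset by blast
    show "card (P j b) = m j b"
      using part that by (auto simp: block_partition_def)
  qed
  have disj: "b = b'" if "j < length ts" "b < ts ! j" "b' < ts ! j" "x \<in> P j b" "x \<in> P j b'" for j b b' x
  proof -
    have "disjoint (P j ` {..<ts ! j})" "inj_on (P j) {..<ts ! j}"
      using part that(1) by (auto simp: block_partition_def partition_on_def)
    moreover from this(1) have "P j b = P j b'"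
      using that disjointD[of "P j ` {..<ts ! j}" "P j b" "P j b'"] by auto
    ultimately show ?thesis
      using that by (simp add: inj_on_eq_iff)
  qed
  have x: "length xss = length ts" "j < length ts \<Longrightarrow> length (xss ! j) = ts ! j"
    "j < length ts \<Longrightarrow> b < ts ! j \<Longrightarrow> xss ! j ! b < m j b" if "xss \<in> ?X" for xss j b
    using that by (auto simp: in_listset_iff mss_def indices_def)
  have yP: "y xss j b \<in> P j b" if "xss \<in> ?X" "j < length ts" "b < ts ! j" for xss j b
  proof -
    have "xss ! j ! b < length (sorted_list_of_set (P j b))"
      using x(3)[OF that] P(3)[OF that(2,3)] by simp
    then show ?thesis
      unfolding y_def using nth_mem set_sorted_list_of_set[OF P(2)[OF that(2,3)]] by blast
  qed
  have inj_y: "inj_on (y xss j) {..<ts ! j}" if "xss \<in> ?X" "j < length ts" for xss j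
  proof (rule inj_onI)
    fix b b'
    assume b: "b \<in> {..<ts ! j}" "b' \<in> {..<ts ! j}" and "y xss j b = y xss j b'"
    then show "b = b'"
      using disj[OF that(2), of b b' "y xss j b"] yP[OF that, of b] yP[OF that, of b'] by simp
  qed
  have "S xss \<in> ?app" if X: "xss \<in> ?X" for xss
  proof -
    \<comment> \<open>The rank of a chosen index is sent to the number of its part; outside
      \<open>{..<ts ! j}\<close> the identity is required by \<open>permutes\<close>.\<close>
    define \<pi> where "\<pi> = (\<lambda>j k. if k < ts ! j
      then the_inv_into {..<ts ! j} (y xss j) (sorted_list_of_set (S xss ! j) ! k) else k)"
    have Sj: "S xss ! j = y xss j ` {..<ts ! j}" if "j < length ts" for j
      using that by (simp add: S_def)
    have card: "card (S xss ! j) = ts ! j" if "j < length ts" for j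
      using that inj_y[OF X] by (simp add: Sj card_image)
    have sub: "S xss ! j \<subseteq> {..<ns ! j}" if "j < length ts" for j
      using that yP[OF X] P by (fastforce simp: Sj)
    have sorted: "bij_betw (\<lambda>k. sorted_list_of_set (S xss ! j) ! k) {..<ts ! j} (S xss ! j)"
      if "j < length ts" for j
      using that card[OF that] finite_subset[OF sub[OF that]]
      by (intro bij_betw_nth) auto
    have bij: "bij_betw (y xss j) {..<ts ! j} (S xss ! j)" if "j < length ts" for j
      using inj_y[OF X that] that by (simp add: bij_betw_def Sj)
    have "\<pi> j permutes {..<ts ! j}" if "j < length ts" for j
    proof (rule bij_imp_permutes)
      have "bij_betw (the_inv_into {..<ts ! j} (y xss j) \<circ> (\<lambda>k. sorted_list_of_set (S xss ! j) ! k))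
          {..<ts ! j} {..<ts ! j}"
        using sorted[OF that] bij_betw_the_inv_into[OF bij[OF that]] by (rule bij_betw_trans)
      then show "bij_betw (\<pi> j) {..<ts ! j} {..<ts ! j}"
        by (rule bij_betw_cong[THEN iffD1, rotated]) (simp add: \<pi>_def)
    qed (simp add: \<pi>_def)
    moreover have "submatrix A (S xss) \<beta> = C (map (\<lambda>j. \<pi> j (\<beta> ! j)) [0..<length \<beta>])"
      if \<beta>: "\<beta> \<in> indices ts" for \<beta>
    proof -
      let ?\<gamma> = "map (\<lambda>j. \<pi> j (\<beta> ! j)) [0..<length \<beta>]"
      have \<beta>': "length \<beta> = length ts" "\<And>j. j < length ts \<Longrightarrow> \<beta> ! j < ts ! j"
        using \<beta> by (auto simp: indices_def)
      have \<gamma>: "?\<gamma> \<in> indices ts"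
        using \<beta>' \<open>\<And>j. j < length ts \<Longrightarrow> \<pi> j permutes {..<ts ! j}\<close> permutes_in_image
        by (fastforce simp: indices_def)
      have y\<pi>: "y xss j (\<pi> j (\<beta> ! j)) = sorted_list_of_set (S xss ! j) ! (\<beta> ! j)"
        if "j < length ts" for j
        using that \<beta>' bij_betwE[OF sorted[OF that]] bij[OF that]
        by (auto simp: \<pi>_def intro!: f_the_inv_into_f_bij_betw)
      \<comment> \<open>Both sides address the same entry of \<open>A\<close>: the
        \<open>\<beta> ! j\<close>-th smallest chosen index is the one from part
        \<open>\<pi> j (\<beta> ! j)\<close>.\<close>
      have "map2 (\<lambda>T k. sorted_list_of_set T ! k) (S xss) \<beta> =
          map2 (\<lambda>T k. sorted_list_of_set T ! k) (map (\<lambda>j. P j (?\<gamma> ! j)) [0..<length ?\<gamma>])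
            (map2 (!) xss ?\<gamma>)"
        using x(1)[OF X] \<beta>' y\<pi> by (intro nth_equalityI) (auto simp: S_def y_def)
      then have "submatrix A (S xss) \<beta> = block A P ?\<gamma> (map2 (!) xss ?\<gamma>)"
        by (simp only: submatrix_def block_def)
      also have "\<dots> = C ?\<gamma>"
        using X \<gamma> by blast
      finally show ?thesis .
    qed
    ultimately show ?thesis
      using len card sub by (auto simp: S_def)
  qed
  moreover have "inj_on S ?X"
  proof (rule inj_onI)
    fix xss xss'
    assume X: "xss \<in> ?X" and X': "xss' \<in> ?X" and eq: "S xss = S xss'"
    \<comment> \<open>The set \<open>S xss ! j\<close> meets \<open>P j b\<close> only in the index
      chosen there, so the choice can be read off.\<close>
    have "xss ! j ! b = xss' ! j ! b" if j: "j < length ts" and b: "b < ts ! j" for j b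
    proof -
      have "S xss ! j = S xss' ! j"
        using eq by simp
      then have "y xss j ` {..<ts ! j} = y xss' j ` {..<ts ! j}"
        using j by (simp add: S_def)
      then obtain b' where b': "b' < ts ! j" "y xss j b = y xss' j b'"
        using b by (metis imageE imageI lessThan_iff)
      then have "b' = b"
        using disj[OF j b' (1) b] yP[OF X j b] yP[OF X' j b'(1)] by simp
      then show ?thesis
        using b' x(3)[OF X j b] x(3)[OF X' j b] P[OF j b]
        by (simp add: y_def nth_eq_iff_index_eq)
    qed
    then show "xss = xss'"
      using x[OF X] x[OF X'] by (intro nth_equalityI) auto
  qed
  \<comment> \<open>An infinite set would have \<open>card\<close> 0, so injectivity alone gives no
    inequality.\<close>
  moreover have "finite ?app"
  proof (rule finite_subset)
    show "?app \<subseteq> listset (map (\<lambda>n. Pow {..<n}) ns)"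
      by (auto simp: in_listset_iff)
  qed (auto intro!: finite_listset)
  ultimately show ?thesis
    unfolding appearances_def by (intro card_inj_on_le[of S] image_subsetI)
qed

section \<open>The choice of \<open>\<epsilon>\<close> and the final bound\<close>

theorem theorem5:
  fixes d :: nat and \<delta> :: real and ts :: "nat list"
    and \<rho> :: "nat list \<Rightarrow> 'a::finite \<Rightarrow> real"
  assumes "d \<ge> 2" and "\<delta> > 0"
    and "length ts = d" and "\<forall>j < d. ts ! j \<ge> 1"
    and "\<forall>\<beta> \<in> indices ts. \<forall>\<sigma>. 0 < \<rho> \<beta> \<sigma> \<and> \<rho> \<beta> \<sigma> \<le> 1"
  shows "\<exists>\<epsilon> > 0. \<forall>(ns :: nat list) (A :: nat list \<Rightarrow> 'a) m P.
    block_partition ns ts m P \<longrightarrow>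
    (\<forall>\<beta> \<in> indices ts.
       regular_pattern \<epsilon> d (block_sizes m \<beta>) (\<lambda>\<alpha>. Some (block A P \<beta> \<alpha>)) (\<rho> \<beta>)) \<longrightarrow>
    (\<forall>C :: nat list \<Rightarrow> 'a.
       (1 - \<delta>) * (\<Prod>j<d. \<Prod>b<ts ! j. real (m j b)) * (\<Prod>\<beta>\<in>indices ts. \<rho> \<beta> (C \<beta>))
         \<le> real (appearances ts C ns A))"
proof -
  define K where "K = real (loss ts)"
  \<comment> \<open>\<open>\<epsilon>\<close> must not depend on \<open>C\<close>, so the densities
    are bounded by their minima over the finite alphabet.\<close>
  define c where "c = (\<Prod>\<beta>\<in>indices ts. Min (range (\<rho> \<beta>)))"
  \<comment> \<open>Chosen so that \<open>K * \<epsilon> \<le> \<delta>\<close>, which bounds the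
    total loss, and \<open>\<epsilon> + K * \<epsilon> \<le> c\<close>, which keeps the test
    patterns dense enough.\<close>
  define \<epsilon> where "\<epsilon> = min c \<delta> / (2 * (K + 1))"
  have Min: "0 < Min (range (\<rho> \<beta>))" "Min (range (\<rho> \<beta>)) \<le> \<rho> \<beta> \<sigma>" if "\<beta> \<in> indices ts" for \<beta> \<sigma>
    using assms(5) that by auto
  have c: "0 < c" "c \<le> (\<Prod>\<beta>\<in>indices ts. \<rho> \<beta> (C \<beta>))" for C
    unfolding c_def using Min by (simp_all add: prod_pos prod_mono less_imp_le)
  have rho_le_1: "(\<Prod>\<beta>\<in>indices ts. \<rho> \<beta> (C \<beta>)) \<le> 1" for C
    using assms(5) by (simp add: prod_le_1 less_imp_le)
  then have "c \<le> 1"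
    using c(2) order_trans by blast
  have K: "0 \<le> K"
    by (simp add: K_def)
  have \<epsilon>_pos: "0 < \<epsilon>"
    using c(1) assms(2) K by (simp add: \<epsilon>_def)
  have \<epsilon>K: "\<epsilon> * (K + 1) = min c \<delta> / 2"
    using K by (simp add: \<epsilon>_def field_simps)
  have K\<epsilon>: "0 \<le> K * \<epsilon>"
    using K \<epsilon>_pos by simp
  have \<epsilon>: "\<epsilon> < 1" "K * \<epsilon> \<le> \<delta>" "K * \<epsilon> < 1" "\<epsilon> + K * \<epsilon> \<le> c"
    using \<epsilon>K K\<epsilon> \<epsilon>_pos \<open>c \<le> 1\<close> c(1) assms(2) by (auto simp: algebra_simps)
  show ?thesis
  proof (intro exI[of _ \<epsilon>] conjI allI impI)
    fix ns m P and A C :: "nat list \<Rightarrow> 'a"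
    assume part: "block_partition ns ts m P"
      and reg: "\<forall>\<beta> \<in> indices ts.
        regular_pattern \<epsilon> d (block_sizes m \<beta>) (\<lambda>\<alpha>. Some (block A P \<beta> \<alpha>)) (\<rho> \<beta>)"
    define mss where "mss = map (\<lambda>j. map (m j) [0..<ts ! j]) [0..<length ts]"
    define p where "p = (\<Prod>\<beta>\<in>indices ts. \<rho> \<beta> (C \<beta>))"
    define M where "M = (\<Prod>j<d. \<Prod>b<ts ! j. real (m j b))"
    have ts: "map length mss = ts" and len: "length mss = d"
      using assms(3) by (auto simp: mss_def map_nth intro: nth_equalityI)
    have M: "real (\<Prod>ms\<leftarrow>mss. prod_list ms) = M"
      by (simp add: M_def mss_def assms(3) prod.list_conv_set_nth atLeast0LessThan)
    have sizes: "map2 (!) mss \<beta> = block_sizes m \<beta>" if "\<beta> \<in> indices ts" for \<beta>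
      using that by (intro nth_equalityI) (auto simp: mss_def block_sizes_def indices_def)
    \<comment> \<open>Parts of a partition are nonempty, and finite here.\<close>
    have m_pos: "0 < m j b" if "j < length ts" "b < ts ! j" for j b
    proof -
      have "partition_on {..<ns ! j} (P j ` {..<ts ! j})" "card (P j b) = m j b"
        using part that by (auto simp: block_partition_def)
      then have "P j b \<noteq> {}" "finite (P j b)" "card (P j b) = m j b"
        using that by (auto simp: partition_on_def intro: finite_subset[of _ "{..<ns ! j}"])
      then show ?thesis
        by (metis card_gt_0_iff)
    qed
    have "(1 - K * \<epsilon>) * M * p \<le> real (card {xss \<in> listset (map indices mss).
        \<forall>\<beta>\<in>indices ts. block A P \<beta> (map2 (!) xss \<beta>) = C \<beta>})"
      unfolding K_def p_def M[symmetric] ts[symmetric]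
    proof (rule count_blockwise)
      show "mss \<noteq> []"
        using len assms(1) by auto
      show "\<forall>ms\<in>set mss. \<forall>m\<in>set ms. 0 < m"
        using m_pos by (auto simp: mss_def)
      show "\<forall>\<beta>\<in>indices (map length mss). pattern_ge \<epsilon> (length mss) (map2 (!) mss \<beta>)
          (\<lambda>\<alpha>. block A P \<beta> \<alpha> = C \<beta>) (\<rho> \<beta> (C \<beta>)) \<and> 0 < \<rho> \<beta> (C \<beta>)"
        unfolding ts len
      proof
        fix \<beta>
        assume \<beta>: "\<beta> \<in> indices ts"
        have "binary_regular_pattern \<epsilon> d (block_sizes m \<beta>) (\<lambda>\<alpha>. block A P \<beta> \<alpha> = C \<beta>) (\<rho> \<beta> (C \<beta>))"
          using regular_pattern_imp_binary[OF reg[rule_format, OF \<beta>], of "C \<beta>"] by simp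
        then show "pattern_ge \<epsilon> d (map2 (!) mss \<beta>) (\<lambda>\<alpha>. block A P \<beta> \<alpha> = C \<beta>) (\<rho> \<beta> (C \<beta>))
            \<and> 0 < \<rho> \<beta> (C \<beta>)"
          using assms(5) \<beta> by (auto simp: pattern_ge_def sizes)
      qed
      have "\<epsilon> \<le> p * (1 - K * \<epsilon>)"
      proof -
        \<comment> \<open>Since \<open>c \<le> 1\<close>, \<open>c * (1 - K * \<epsilon>) \<ge> c -
          K * \<epsilon> \<ge> \<epsilon>\<close>.\<close>
        have "c * (1 - K * \<epsilon>) \<le> p * (1 - K * \<epsilon>)"
          using c(2) \<epsilon> by (intro mult_right_mono) (auto simp: p_def)
        moreover have "c * (K * \<epsilon>) \<le> K * \<epsilon>"
          using \<open>c \<le> 1\<close> K\<epsilon> by (rule mult_left_le_one_le[rotated 2]) (use c in auto)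
        ultimately show ?thesis
          using \<epsilon>(4) by (simp add: algebra_simps)
      qed
      then show "\<epsilon> \<le> (\<Prod>\<beta>\<in>indices (map length mss). \<rho> \<beta> (C \<beta>)) *
          (1 - real (loss (map length mss)) * \<epsilon>)"
        by (simp only: p_def K_def ts)
    qed (use \<epsilon>_pos \<epsilon> in auto)
    also have "\<dots> \<le> real (appearances ts C ns A)"
      unfolding mss_def using choices_le_appearances[OF part] by (rule of_nat_mono)
    finally have "(1 - K * \<epsilon>) * M * p \<le> real (appearances ts C ns A)" .
    moreover have "0 \<le> p"
      using c(1) c(2)[of C] unfolding p_def by linarith
    then have "(1 - \<delta>) * (M * p) \<le> (1 - K * \<epsilon>) * (M * p)"
      using \<epsilon> by (intro mult_right_mono mult_nonneg_nonneg) (simp_all add: M_def prod_nonneg)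
    ultimately show "(1 - \<delta>) * (\<Prod>j<d. \<Prod>b<ts ! j. real (m j b)) * (\<Prod>\<beta>\<in>indices ts. \<rho> \<beta> (C \<beta>))
        \<le> real (appearances ts C ns A)"
      unfolding M_def[symmetric] p_def[symmetric] by (simp add: mult.assoc)
  qed (rule \<epsilon>_pos)
qed

end
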